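(* Let $\bar{x} \in \mathcal{ST}_G$ and let $u(\bar x)$ be the optimal value of $$({\rm PU}_{\bar x})\qquad u(\bar x)=\min\Big\{\sum_{e\in E} u_e\bar x_e \;:\; u\in\mathcal{U}\Big\}.$$ For every $e\in E$, let $\widehat U_e$ be an upper bound on the maximum value $\widetilde U_e$ of the length of edge $e$, and let $\widehat u_e$ be a lower bound on the minimum value $\widetilde u_e$ of the length of edge $e$ (for instance $\widehat U_e=\widetilde U_e$, $\widehat u_e=\widetilde u_e$). Then $$\Theta \;\geq\; u(\bar x) + \sum_{e\in E:\, \bar x_e=1} \widehat{U}_e (x_e-1) + \sum_{e\in E:\, \bar x_e=0} \widehat{u}_e x_e$$ is a valid cut for MSTN; that is, this inequality, with $\Theta=\sum_{e\in E}\theta_e$, is satisfied by every feasible solution $(x,u,\theta)$ of the linearized formulation (RL-MSTN) of the MSTN problem.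
   Context: Setting. $G=(V,E)$ is a connected undirected graph with vertices embedded in $\mathbb{R}^d$ ($v\in\mathbb{R}^d$ for $v\in V$). Each $v\in V$ has a neighborhood $\mathcal{N}_v\subseteq\mathbb{R}^d$, a convex set containing $v$ in its interior, which is second order cone representable (e.g. a ball of an $\ell_p$-norm or a bounded polyhedron). $\|\cdot\|$ is a given norm on $\mathbb{R}^d$ and $d(y,y')=\|y-y'\|$. $\mathcal{Y}=\prod_{v\in V}\mathcal{N}_v$. $\mathcal{ST}_G\subset\{0,1\}^{E}$ is the set of incidence vectors of spanning trees of $G$. The Minimum Spanning Tree with Neighborhoods problem (MSTN) is to minimize $\sum_{e=\{v,w\}\in E} d(y_v,y_w)\,x_e$ over $x\in\mathcal{ST}_G$, $y\in\mathcal{Y}$. $\mathcal{U}=\{u\in\mathbb{R}^{E}_+ : \text{there is } y\in\mathcal{Y} \text{ with } u_e\ge d(y_v,y_w) \text{ for all } e=\{v,w\}\in E\}$. For $e=\{v,w\}\in E$: $\widetilde U_e=\max\{d(y_v,y_w): y_v\in\mathcal{N}_v, y_w\in\mathcal{N}_w\}$ and $\widetilde u_e=\min\{d(y_v,y_w): y_v\in\mathcal{N}_v, y_w\in\mathcal{N}_w\}$ (these extrema are assumed to exist). Linearized formulation (RL-MSTN) of MSTN: minimize $\Theta=\sum_{e\in E}\theta_e$ subject to $\theta_e\ge u_e-\widetilde U_e(1-x_e)$ and $\theta_e\ge 0$ for all $e\in E$, $x\in\mathcal{ST}_G$, $u\in\mathcal{U}$. *)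

theory Defs
  imports "HOL-Analysis.Analysis"
begin

section \<open>Graphs and spanning trees\<close>

text \<open>
  Finite simple undirected graphs, with edges as two-element vertex sets.
  (The AFP notions on digraphs do not fit: the forests of Graph_Theory exclude
  directed cycles only, and edge-indexed vectors would be indexed by arcs.)
\<close>

definition simple_graph :: "'v set \<Rightarrow> 'v set set \<Rightarrow> bool" where
  "simple_graph V E \<longleftrightarrow> finite V \<and> (\<forall>e\<in>E. \<exists>v\<in>V. \<exists>w\<in>V. v \<noteq> w \<and> e = {v, w})"

definition connected_graph :: "'v set \<Rightarrow> 'v set set \<Rightarrow> bool" where
  "connected_graph V E \<longleftrightarrow> V \<noteq> {} \<and> (\<forall>v\<in>V. \<forall>w\<in>V. (v, w) \<in> {(a, b). {a, b} \<in> E}\<^sup>*)"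

text \<open>A cycle is given by its cyclic sequence of pairwise distinct vertices.\<close>

definition acyclic_graph :: "'v set set \<Rightarrow> bool" where
  "acyclic_graph E \<longleftrightarrow>
     (\<nexists>vs. 3 \<le> length vs \<and> distinct vs \<and>
           (\<forall>i<length vs. {vs ! i, vs ! (Suc i mod length vs)} \<in> E))"

definition spanning_tree :: "'v set \<Rightarrow> 'v set set \<Rightarrow> 'v set set \<Rightarrow> bool" where
  "spanning_tree V E T \<longleftrightarrow> T \<subseteq> E \<and> connected_graph V T \<and> acyclic_graph T"

text \<open>
  A vector indexed by \<open>E\<close> is a function on all vertex sets of which only
  the values on \<open>E\<close> matter; all definitions below are insensitive to the others.
\<close>

definition ST :: "'v set \<Rightarrow> 'v set set \<Rightarrow> ('v set \<Rightarrow> real) set" where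
  "ST V E = {x. (\<forall>e\<in>E. x e \<in> {0, 1}) \<and> spanning_tree V E {e \<in> E. x e = 1}}"


section \<open>Norms and neighborhoods\<close>

text \<open>An arbitrary norm on the space; the class operation \<open>norm\<close> is the Euclidean one.\<close>

definition is_norm :: "('a::real_vector \<Rightarrow> real) \<Rightarrow> bool" where
  "is_norm nrm \<longleftrightarrow>
     (\<forall>x. 0 \<le> nrm x) \<and> (\<forall>x. nrm x = 0 \<longleftrightarrow> x = 0) \<and>
     (\<forall>c x. nrm (c *\<^sub>R x) = \<bar>c\<bar> * nrm x) \<and>
     (\<forall>x y. nrm (x + y) \<le> nrm x + nrm y)"

text \<open>
  A set is second order cone representable if it is the projection of a set described
  by finitely many constraints requiring a vector of affine functions of \<open>(x, z)\<close>,
  with auxiliary variables \<open>z\<close>, to lie in a second order cone.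
  There are \<open>m\<close> auxiliary variables and \<open>k\<close> constraints;
  \<open>a i j\<close>, \<open>g i j\<close>, \<open>c i j\<close> are the coefficients of the \<open>j\<close>-th
  component of the \<open>i\<close>-th constraint, whose cone lives in dimension \<open>p i + 1\<close>.
\<close>

definition second_order_cone :: "nat \<Rightarrow> (nat \<Rightarrow> real) set" where
  "second_order_cone p = {s. L2_set s {1..p} \<le> s 0}"

definition soc_representable :: "'a::euclidean_space set \<Rightarrow> bool" where
  "soc_representable S \<longleftrightarrow>
     (\<exists>(m::nat) (k::nat) (p::nat \<Rightarrow> nat) (a::nat \<Rightarrow> nat \<Rightarrow> 'a)
        (g::nat \<Rightarrow> nat \<Rightarrow> nat \<Rightarrow> real) (c::nat \<Rightarrow> nat \<Rightarrow> real).
        S = {x. \<exists>z::nat \<Rightarrow> real. \<forall>i<k.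
               (\<lambda>j. a i j \<bullet> x + (\<Sum>l<m. g i j l * z l) + c i j) \<in> second_order_cone (p i)})"

definition neighborhood :: "'a::euclidean_space \<Rightarrow> 'a set \<Rightarrow> bool" where
  "neighborhood v S \<longleftrightarrow> convex S \<and> v \<in> interior S \<and> soc_representable S"


section \<open>The minimum spanning tree problem with neighborhoods\<close>

definition edge_lengths ::
  "('a::real_vector \<Rightarrow> real) \<Rightarrow> ('a \<Rightarrow> 'a set) \<Rightarrow> 'a set \<Rightarrow> real set" where
  "edge_lengths nrm N e = {nrm (y - y') | v w y y'. e = {v, w} \<and> y \<in> N v \<and> y' \<in> N w}"

text \<open>
  \<open>GREATEST\<close> and \<open>LEAST\<close> pick the maximum and the minimum when these are
  attained, and are unspecified otherwise.
\<close>

definition U_max :: "('a::real_vector \<Rightarrow> real) \<Rightarrow> ('a \<Rightarrow> 'a set) \<Rightarrow> 'a set \<Rightarrow> real" where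
  "U_max nrm N e = (GREATEST l. l \<in> edge_lengths nrm N e)"

definition u_min :: "('a::real_vector \<Rightarrow> real) \<Rightarrow> ('a \<Rightarrow> 'a set) \<Rightarrow> 'a set \<Rightarrow> real" where
  "u_min nrm N e = (LEAST l. l \<in> edge_lengths nrm N e)"

definition extrema_exist ::
  "('a::real_vector \<Rightarrow> real) \<Rightarrow> ('a \<Rightarrow> 'a set) \<Rightarrow> 'a set \<Rightarrow> bool" where
  "extrema_exist nrm N e \<longleftrightarrow>
     (\<exists>l\<in>edge_lengths nrm N e. \<forall>l'\<in>edge_lengths nrm N e. l' \<le> l) \<and>
     (\<exists>l\<in>edge_lengths nrm N e. \<forall>l'\<in>edge_lengths nrm N e. l \<le> l')"

definition U_set ::
  "('a::real_vector \<Rightarrow> real) \<Rightarrow> 'a set \<Rightarrow> 'a set set \<Rightarrow> ('a \<Rightarrow> 'a set) \<Rightarrow> ('a set \<Rightarrow> real) set" where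
  "U_set nrm V E N =
     {u. (\<forall>e\<in>E. 0 \<le> u e) \<and>
         (\<exists>y\<in>(\<Pi> v\<in>V. N v). \<forall>v w. {v, w} \<in> E \<longrightarrow> nrm (y v - y w) \<le> u {v, w})}"

text \<open>
  The optimal value of the subproblem for a fixed incidence vector \<open>x\<close>.
  The infimum is taken over a nonempty set of nonnegative reals, so it is
  the minimum whenever that is attained.
\<close>

definition PU_value ::
  "('a::real_vector \<Rightarrow> real) \<Rightarrow> 'a set \<Rightarrow> 'a set set \<Rightarrow> ('a \<Rightarrow> 'a set) \<Rightarrow> ('a set \<Rightarrow> real) \<Rightarrow> real" where
  "PU_value nrm V E N x = (INF u\<in>U_set nrm V E N. \<Sum>e\<in>E. u e * x e)"

definition RL_MSTN_feasible ::
  "('a::real_vector \<Rightarrow> real) \<Rightarrow> 'a set \<Rightarrow> 'a set set \<Rightarrow> ('a \<Rightarrow> 'a set) \<Rightarrow>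
   (('a set \<Rightarrow> real) \<times> ('a set \<Rightarrow> real) \<times> ('a set \<Rightarrow> real)) set" where
  "RL_MSTN_feasible nrm V E N =
     {(x, u, \<theta>). x \<in> ST V E \<and> u \<in> U_set nrm V E N \<and>
        (\<forall>e\<in>E. u e - U_max nrm N e * (1 - x e) \<le> \<theta> e \<and> 0 \<le> \<theta> e)}"

end

theory Submission
  imports Defs
begin

text \<open>
  Let \<open>y\<close> witness \<open>u \<in> \<U>\<close>. Truncating \<open>u\<close> at the maximal edge lengths keeps it in \<open>\<U>\<close>
  with the same \<open>y\<close>, so the truncated vector bounds \<open>u(xbar)\<close> from above. The cut then splits
  into one inequality per edge, checked for the four values of \<open>(xbar e, x e)\<close>; the truncation is
  what makes the case \<open>(1, 0)\<close>, where only \<open>\<theta> e \<ge> 0\<close> is available, go through.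
\<close>

text \<open>\<open>GREATEST\<close> is meaningful only when a maximum is attained;
  \<open>extrema_exist\<close> supplies a maximizer, and antisymmetry of the order identifies it
  with \<open>U_max\<close>.\<close>

lemma edge_length_le_U_max:
  assumes "extrema_exist nrm N e" and "l \<in> edge_lengths nrm N e"
  shows "l \<le> U_max nrm N e"
proof -
  obtain m where m: "m \<in> edge_lengths nrm N e" "\<forall>l'\<in>edge_lengths nrm N e. l' \<le> m"
    using assms(1) unfolding extrema_exist_def by blast
  have "U_max nrm N e = m"
    unfolding U_max_def by (rule Greatest_equality) (use m in auto)
  with m assms(2) show ?thesis by simp
qed

lemma u_min_le_edge_length:
  assumes "extrema_exist nrm N e" and "l \<in> edge_lengths nrm N e"
  shows "u_min nrm N e \<le> l"
proof -
  obtain m where m: "m \<in> edge_lengths nrm N e" "\<forall>l'\<in>edge_lengths nrm N e. m \<le> l'"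
    using assms(1) unfolding extrema_exist_def by blast
  have "u_min nrm N e = m"
    unfolding u_min_def by (rule Least_equality) (use m in auto)
  with m assms(2) show ?thesis by simp
qed

lemma simple_graph_edge:
  assumes "simple_graph V E" and "e \<in> E"
  obtains v w where "v \<in> V" "w \<in> V" "e = {v, w}"
  using assms unfolding simple_graph_def by blast

lemma simple_graph_edge_subset:
  assumes "simple_graph V E" and "e \<in> E"
  shows "e \<subseteq> V"
  using assms by (elim simple_graph_edge) auto

lemma simple_graph_finite_edges:
  assumes "simple_graph V E"
  shows "finite E"
proof (rule finite_subset)
  show "E \<subseteq> Pow V" using simple_graph_edge_subset[OF assms] by blast
  show "finite (Pow V)" using assms by (simp add: simple_graph_def)
qed

text \<open>An infimum of reals lies below the members only if the set is bounded below; as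
  \<open>u\<close> and \<open>x\<close> are nonnegative on \<open>E\<close>, 0 is such a bound.
  Attainment of the minimum plays no part in the argument.\<close>

lemma PU_value_le:
  assumes "\<forall>e\<in>E. 0 \<le> x e" and "u \<in> U_set nrm V E N"
  shows "PU_value nrm V E N x \<le> (\<Sum>e\<in>E. u e * x e)"
  unfolding PU_value_def
proof (rule cINF_lower[OF _ assms(2)])
  show "bdd_below ((\<lambda>u. \<Sum>e\<in>E. u e * x e) ` U_set nrm V E N)"
    using assms(1) by (intro bdd_belowI2[of _ 0] sum_nonneg) (auto simp: U_set_def)
qed

theorem theorem4p1:
  fixes nrm :: "real ^ 'd \<Rightarrow> real"
    and V :: "(real ^ 'd) set"
    and E :: "(real ^ 'd) set set"
    and N :: "real ^ 'd \<Rightarrow> (real ^ 'd) set"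
    and xbar x u \<theta> Uhat uhat :: "(real ^ 'd) set \<Rightarrow> real"
  assumes "is_norm nrm"
    and "simple_graph V E"
    and "connected_graph V E"
    and "\<forall>v\<in>V. neighborhood v (N v)"
    and "\<forall>e\<in>E. extrema_exist nrm N e"
    and "xbar \<in> ST V E"
    and "\<forall>e\<in>E. U_max nrm N e \<le> Uhat e"
    and "\<forall>e\<in>E. uhat e \<le> u_min nrm N e"
    and "(x, u, \<theta>) \<in> RL_MSTN_feasible nrm V E N"
  shows "(\<Sum>e\<in>E. \<theta> e) \<ge>
           PU_value nrm V E N xbar
           + (\<Sum>e\<in>{e \<in> E. xbar e = 1}. Uhat e * (x e - 1))
           + (\<Sum>e\<in>{e \<in> E. xbar e = 0}. uhat e * x e)"
proof -
  note extrema = assms(5)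
  obtain y where y: "\<forall>v\<in>V. y v \<in> N v"
    and yu: "\<And>v w. {v, w} \<in> E \<Longrightarrow> nrm (y v - y w) \<le> u {v, w}"
    using assms(9) by (auto simp: RL_MSTN_feasible_def U_set_def)
  have nrm_nonneg: "0 \<le> nrm z" for z
    using assms(1) by (simp add: is_norm_def)
  have len: "nrm (y v - y w) \<in> edge_lengths nrm N {v, w}" if "{v, w} \<in> E" for v w
    using simple_graph_edge_subset[OF assms(2) that] y unfolding edge_lengths_def by blast
  have fin: "finite E"
    by (rule simple_graph_finite_edges[OF assms(2)])
  have xbar01: "xbar e = 0 \<or> xbar e = 1" if "e \<in> E" for e
    using assms(6) that by (auto simp: ST_def)
  have x01: "x e = 0 \<or> x e = 1" if "e \<in> E" for e
    using assms(9) that by (auto simp: RL_MSTN_feasible_def ST_def)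
  have theta: "u e - U_max nrm N e * (1 - x e) \<le> \<theta> e" "0 \<le> \<theta> e" if "e \<in> E" for e
    using assms(9) that by (auto simp: RL_MSTN_feasible_def)
  define u' where "u' e = min (u e) (U_max nrm N e)" for e
  have u'_ge: "nrm (y v - y w) \<le> u' {v, w}" if "{v, w} \<in> E" for v w
    using yu[OF that] edge_length_le_U_max[OF _ len[OF that]] extrema that
    by (simp add: u'_def)
  \<comment> \<open>The sign of the truncated value follows from the length it dominates, so no
    separate sign argument for \<open>U_max\<close> arises.\<close>
  have "0 \<le> u' e" if "e \<in> E" for e
  proof -
    obtain v w where "e = {v, w}"
      using assms(2) \<open>e \<in> E\<close> by (rule simple_graph_edge)
    with that show ?thesis
      using u'_ge[of v w] nrm_nonneg[of "y v - y w"] by simp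
  qed
  with y u'_ge have "u' \<in> U_set nrm V E N"
    by (auto simp: U_set_def)
  moreover have "\<forall>e\<in>E. 0 \<le> xbar e"
    using xbar01 by fastforce
  ultimately have PU: "PU_value nrm V E N xbar \<le> (\<Sum>e\<in>E. u' e * xbar e)"
    by (intro PU_value_le)
  \<comment> \<open>Used for edges with \<open>xbar e = 0\<close> and \<open>x e = 1\<close>, where
    \<open>\<theta> e\<close> is at least \<open>u e\<close> and must cover
    \<open>uhat e\<close>.\<close>
  have u_ge: "uhat e \<le> u e" if "e \<in> E" for e
  proof -
    obtain v w where e: "e = {v, w}"
      using assms(2) \<open>e \<in> E\<close> by (rule simple_graph_edge)
    have "uhat e \<le> u_min nrm N e" using assms(8) that by blast
    also have "\<dots> \<le> nrm (y v - y w)"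
      using u_min_le_edge_length extrema len that e by blast
    also have "\<dots> \<le> u e" using yu that e by blast
    finally show ?thesis .
  qed
  \<comment> \<open>By \<open>(xbar e, x e)\<close>: for (1,1) the left side is \<open>u' e\<close>,
    at most \<open>u e\<close>; for (1,0) it is \<open>u' e - Uhat e\<close>, at most 0; for (0,1)
    it is \<open>uhat e\<close>; for (0,0) it is 0.\<close>
  have edge: "u' e * xbar e + (if xbar e = 1 then Uhat e * (x e - 1) else 0)
                + (if xbar e = 0 then uhat e * x e else 0) \<le> \<theta> e" if "e \<in> E" for e
  proof -
    have "U_max nrm N e \<le> Uhat e"
      using assms(7) that by blast
    with xbar01[OF that] x01[OF that] theta[OF that] u_ge[OF that] show ?thesis
      by (auto simp: u'_def min_le_iff_disj)
  qed
  \<comment> \<open>Finiteness of \<open>E\<close> lets the two sums over filtered edge sets become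
    sums over \<open>E\<close> with conditional summands, so that all three merge edge by
    edge.\<close>
  have "PU_value nrm V E N xbar
          + (\<Sum>e\<in>{e \<in> E. xbar e = 1}. Uhat e * (x e - 1))
          + (\<Sum>e\<in>{e \<in> E. xbar e = 0}. uhat e * x e)
        \<le> (\<Sum>e\<in>E. u' e * xbar e + (if xbar e = 1 then Uhat e * (x e - 1) else 0)
                + (if xbar e = 0 then uhat e * x e else 0))"
    using PU by (simp add: sum.distrib sum.inter_filter[OF fin])
  also have "\<dots> \<le> (\<Sum>e\<in>E. \<theta> e)"
    by (intro sum_mono edge)
  finally show ?thesis .
qed

end
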